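(* Let $d,m,n$ be positive integers, let $A=\{(i,j)\in\mathbb{Z}^2: 0\le i<m,\ 0\le j<n\}$, and let $D=\{(a_h,b_h): h=1,\dots,d\}$ be a set of $d$ distinct pairs of coprime integers with $a_h\ge 0$, and $b_h=1$ whenever $a_h=0$. Let $f:A\to\mathbb{R}$ be an unknown function with line sums $$\ell_{h,t}=\sum_{(i,j)\in A,\ b_h i-a_h j=t} f(i,j)\qquad (h=1,\dots,d,\ t\in\mathbb{Z}),$$ and suppose measured values $\ell^*_{h,t}$ are given for all $h=1,\dots,d$, $t\in\mathbb{Z}$. Let $1\le k<d$ and suppose it is known that $\ell^*_{h,t}=\ell_{h,t}$ for all $h=1,\dots,k$ and all $t\in\mathbb{Z}$. Then for every direction index $H$ with $k<H\le d$: (i) if the number of $t\in\mathbb{Z}$ with $\ell^*_{H,t}\neq\ell_{H,t}$ is less than $k/2$, then the correct line sums $\ell_{H,t}$ ($t\in\mathbb{Z}$) can be determined from the measured data; (ii) if the number of $t\in\mathbb{Z}$ with $\ell^*_{H,t}\neq\ell_{H,t}$ is at most $k$ and the set of these $t$ is known, then the correct line sums $\ell_{H,t}$ ($t\in\mathbb{Z}$) can be determined from the measured data and this set.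
   Context: A pair $(h,t)$ with $\ell^*_{h,t}\neq\ell_{h,t}$ is called a wrong line sum. "Can be determined" means uniquely determined by (and computable from) the given data. *)

theory Defs
  imports Complex_Main "HOL-Library.Indicator_Function"
begin

definition grid :: "nat \<Rightarrow> nat \<Rightarrow> (int \<times> int) set" where
  "grid m n = {(i, j). 0 \<le> i \<and> i < int m \<and> 0 \<le> j \<and> j < int n}"

definition direction :: "int \<times> int \<Rightarrow> bool" where
  "direction v \<longleftrightarrow> (case v of (a, b) \<Rightarrow> coprime a b \<and> 0 \<le> a \<and> (a = 0 \<longrightarrow> b = 1))"

definition line_sum :: "(int \<times> int) set \<Rightarrow> int \<times> int \<Rightarrow> (int \<times> int \<Rightarrow> real) \<Rightarrow> int \<Rightarrow> real" where
  "line_sum A v f t = (\<Sum>(i, j)\<in>{(i, j)\<in>A. snd v * i - fst v * j = t}. f (i, j))"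

definition wrong_line_sums ::
  "(int \<times> int) set \<Rightarrow> int \<times> int \<Rightarrow> (int \<times> int \<Rightarrow> real) \<Rightarrow> (int \<Rightarrow> real) \<Rightarrow> int set" where
  "wrong_line_sums A v f ms = {t. ms t \<noteq> line_sum A v f t}"

text \<open>Computability over the reals is understood in the exact-arithmetic model: a program is a
  finite algebraic computation tree over the inputs, with rational constants, the four field
  operations and branching on order comparisons.\<close>

datatype 'v program =
    Const rat
  | Input 'v
  | Add "'v program" "'v program"
  | Sub "'v program" "'v program"
  | Mul "'v program" "'v program"
  | Div "'v program" "'v program"
  | IfLe "'v program" "'v program" "'v program" "'v program"

primrec run :: "'v program \<Rightarrow> ('v \<Rightarrow> real) \<Rightarrow> real" where
  "run (Const c) \<rho> = of_rat c"
| "run (Input v) \<rho> = \<rho> v"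
| "run (Add p q) \<rho> = run p \<rho> + run q \<rho>"
| "run (Sub p q) \<rho> = run p \<rho> - run q \<rho>"
| "run (Mul p q) \<rho> = run p \<rho> * run q \<rho>"
| "run (Div p q) \<rho> = run p \<rho> / run q \<rho>"
| "run (IfLe p q r s) \<rho> = (if run p \<rho> \<le> run q \<rho> then run r \<rho> else run s \<rho>)"

text \<open>Below, \<open>X\<close> is the set of all situations compatible with what is known a priori, \<open>obs x\<close> is
  the data available in situation \<open>x\<close>, and \<open>val x\<close> is the quantity to be recovered.\<close>

definition uniquely_determined :: "'x set \<Rightarrow> ('x \<Rightarrow> 'o) \<Rightarrow> ('x \<Rightarrow> 'r) \<Rightarrow> bool" where
  "uniquely_determined X obs val \<longleftrightarrow> (\<forall>x\<in>X. \<forall>y\<in>X. obs x = obs y \<longrightarrow> val x = val y)"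

text \<open>The programs must work for all situations in \<open>X\<close>; almost all of them are trivial, so that the
  family \<open>P\<close> as a whole is a finite object.\<close>

definition computable_from ::
  "'x set \<Rightarrow> ('x \<Rightarrow> 'v \<Rightarrow> real) \<Rightarrow> ('x \<Rightarrow> int \<Rightarrow> real) \<Rightarrow> bool" where
  "computable_from X obs val \<longleftrightarrow>
     (\<exists>P :: int \<Rightarrow> 'v program. finite {t. P t \<noteq> Const 0} \<and>
        (\<forall>x\<in>X. \<forall>t. run (P t) (obs x) = val x t))"

definition can_be_determined ::
  "'x set \<Rightarrow> ('x \<Rightarrow> 'v \<Rightarrow> real) \<Rightarrow> ('x \<Rightarrow> int \<Rightarrow> real) \<Rightarrow> bool" where
  "can_be_determined X obs val \<longleftrightarrow> uniquely_determined X obs val \<and> computable_from X obs val"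

text \<open>Values of \<open>ms\<close> at indices outside \<open>{1..d}\<close> are not part of the data and are masked.\<close>

definition measured_data :: "nat \<Rightarrow> (nat \<Rightarrow> int \<Rightarrow> real) \<Rightarrow> nat \<times> int \<Rightarrow> real" where
  "measured_data d ms = (\<lambda>(h, t). if h \<in> {1..d} then ms h t else 0)"

text \<open>The measured data together with a set of integers, the latter given by its indicator function.\<close>

definition measured_data_with_set ::
  "nat \<Rightarrow> (nat \<Rightarrow> int \<Rightarrow> real) \<Rightarrow> int set \<Rightarrow> (nat \<times> int) + int \<Rightarrow> real" where
  "measured_data_with_set d ms W = case_sum (measured_data d ms) (indicator W)"

end

theory Submission imports Defs "HOL-Computational_Algebra.Polynomial" begin

text \<open>The \<open>r\<close>-th moment of the line sums in direction \<open>(a, b)\<close> is the sum of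
  \<open>f (i, j) * (b i - a j) ^ r\<close> over the grid. For \<open>r < k\<close> the form \<open>(b i - a j) ^ r\<close> is, by Lagrange
  interpolation, a rational combination of the \<open>r\<close>-th powers belonging to the \<open>k\<close> correct directions,
  so the first \<open>k\<close> moments of the errors in direction \<open>H\<close> are linear in the data. Errors
  supported on a known set of at most \<open>k\<close> points are recovered from their first \<open>k\<close> moments by
  Lagrange interpolation again. If the set is unknown but has fewer than \<open>k / 2\<close> points, one
  searches for a set of that size that explains the moments: two solutions differ by
  a function supported on fewer than \<open>k\<close> points with vanishing moments, so they agree.\<close>

subsection \<open>Lagrange interpolation\<close>

text \<open>Stated over any field so that it can be used over the rationals: program constants are
  rational.\<close>

definition lagrange_basis :: "'a::field set \<Rightarrow> 'a \<Rightarrow> 'a poly" where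
  "lagrange_basis S s = (\<Prod>u\<in>S - {s}. smult (1 / (s - u)) [:- u, 1:])"

lemma poly_lagrange_basis:
  assumes "finite S" "s \<in> S" "u \<in> S"
  shows "poly (lagrange_basis S s) u = (if u = s then 1 else 0)"
proof (cases "u = s")
  case True
  have "poly (lagrange_basis S s) s = (\<Prod>u\<in>S - {s}. 1)"
    unfolding lagrange_basis_def poly_prod by (rule prod.cong) (auto simp: field_simps)
  then show ?thesis using True by simp
next
  case False
  then show ?thesis
    using assms unfolding lagrange_basis_def poly_prod by (auto intro!: prod_zero)
qed

lemma degree_lagrange_basis_less:
  assumes "finite S" "s \<in> S"
  shows "degree (lagrange_basis S s) < card S"
proof -
  have "degree (lagrange_basis S s) \<le> (\<Sum>u\<in>S - {s}. degree (smult (1 / (s - u)) [:- u, 1:]))"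
    unfolding lagrange_basis_def using assms by (intro order.trans[OF degree_prod_sum_le]) auto
  also have "\<dots> \<le> (\<Sum>u\<in>S - {s}. 1)"
    by (rule sum_mono) simp
  also have "\<dots> < card S"
    using card_Diff1_less[OF assms] by simp
  finally show ?thesis .
qed

lemma lagrange_interpolation:
  assumes S: "finite S" and p: "degree p < card S"
  shows "poly p z = (\<Sum>s\<in>S. poly p s * poly (lagrange_basis S s) z)"
proof -
  define q where "q = (\<Sum>s\<in>S. smult (poly p s) (lagrange_basis S s))"
  have "degree q \<le> card S - 1"
    unfolding q_def
  proof (rule degree_sum_le[OF S])
    fix s assume "s \<in> S"
    then have "degree (lagrange_basis S s) \<le> card S - 1"
      using degree_lagrange_basis_less[OF S] by fastforce
    then show "degree (smult (poly p s) (lagrange_basis S s)) \<le> card S - 1"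
      using degree_smult_le order.trans by blast
  qed
  \<comment> \<open>The bound on \<open>degree p\<close> forces \<open>card S > 0\<close>, so the
    truncated subtraction in \<open>card S - 1\<close> does no harm.\<close>
  then have q: "degree q < card S" using p by linarith
  have "p = q"
  proof (rule poly_eqI_degree[of S])
    fix u assume u: "u \<in> S"
    have "poly q u = (\<Sum>s\<in>S. if s = u then poly p s else 0)"
      unfolding q_def poly_sum by (rule sum.cong) (auto simp: poly_lagrange_basis S u)
    then show "poly p u = poly q u" using S u by simp
  qed (use p q in auto)
  then have "poly p z = poly q z" by simp
  then show ?thesis by (simp add: q_def poly_sum)
qed

subsection \<open>Recovering a function of small support from its moments\<close>

text \<open>Pairs the moments \<open>s\<close> with the coefficients of the basis polynomial at
  \<open>t\<close>. For fixed \<open>S\<close> and \<open>t\<close> this is a rational linear form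
  in \<open>s\<close>, hence within reach of a program.\<close>

definition recovered :: "nat \<Rightarrow> int set \<Rightarrow> (nat \<Rightarrow> real) \<Rightarrow> int \<Rightarrow> real" where
  "recovered k S s t = (if t \<in> S then
     (\<Sum>r<k. of_rat (coeff (lagrange_basis (of_int ` S) (of_int t)) r) * s r) else 0)"

text \<open>Exchanging sums turns the pairing into the sum of \<open>e u * l(u)\<close> over
  \<open>S\<close>, where the basis polynomial \<open>l\<close> is 1 at \<open>t\<close> and 0
  elsewhere on \<open>S\<close>. Since \<open>card S \<le> k\<close>, its degree is below
  \<open>k\<close> and the first \<open>k\<close> moments suffice.\<close>

lemma recovered_moments:
  fixes e :: "int \<Rightarrow> real"
  assumes T: "finite T" and S: "S \<subseteq> T" "card S \<le> k" and supp: "\<And>u. u \<in> T - S \<Longrightarrow> e u = 0"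
    and t: "t \<in> T" and s: "\<And>r. r < k \<Longrightarrow> s r = (\<Sum>u\<in>T. e u * of_int u ^ r)"
  shows "recovered k S s t = e t"
proof (cases "t \<in> S")
  case False
  then show ?thesis using supp t by (simp add: recovered_def)
next
  case True
  define S' where "S' = (of_int ` S :: rat set)"
  define l where "l = lagrange_basis S' (of_int t)"
  have finS: "finite S" using S T finite_subset by blast
  have cardS': "card S' = card S"
    unfolding S'_def by (rule card_image) (auto simp: inj_on_def)
  have S': "finite S'" "of_int t \<in> S'"
    using finS True by (auto simp: S'_def)
  have deg: "degree l < k"
    using degree_lagrange_basis_less[OF S'] cardS' S(2) by (simp add: l_def)
  have eval: "(\<Sum>r<k. of_rat (coeff l r) * real_of_int u ^ r) = (if u = t then 1 else 0)"
    if "u \<in> S" for u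
  proof -
    have "(\<Sum>r<k. of_rat (coeff l r) * real_of_int u ^ r)
        = of_rat (\<Sum>r<k. coeff l r * of_int u ^ r)"
      by (simp add: of_rat_sum of_rat_mult of_rat_power)
    also have "(\<Sum>r<k. coeff l r * of_int u ^ r) = (\<Sum>r\<le>degree l. coeff l r * of_int u ^ r)"
      using deg by (intro sum.mono_neutral_right) (auto simp: coeff_eq_0)
    also have "\<dots> = poly l (of_int u)" by (simp add: poly_altdef)
    also have "\<dots> = (if u = t then 1 else 0)"
      using poly_lagrange_basis[OF S', of "of_int u"] that by (simp add: l_def S'_def)
    finally show ?thesis by simp
  qed
  have "recovered k S s t = (\<Sum>r<k. of_rat (coeff l r) * (\<Sum>u\<in>T. e u * of_int u ^ r))"
    using True by (simp add: recovered_def l_def S'_def s)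
  also have "\<dots> = (\<Sum>r<k. of_rat (coeff l r) * (\<Sum>u\<in>S. e u * of_int u ^ r))"
  proof -
    have "(\<Sum>u\<in>T. e u * of_int u ^ r) = (\<Sum>u\<in>S. e u * of_int u ^ r)" for r
      using T S supp by (intro sum.mono_neutral_right) auto
    then show ?thesis by simp
  qed
  also have "\<dots> = (\<Sum>u\<in>S. e u * (\<Sum>r<k. of_rat (coeff l r) * of_int u ^ r))"
    unfolding sum_distrib_left by (subst sum.swap) (simp add: mult_ac)
  also have "\<dots> = (\<Sum>u\<in>S. if u = t then e u else 0)"
    by (rule sum.cong) (simp_all add: eval)
  also have "\<dots> = e t" using finS True by simp
  finally show ?thesis .
qed

text \<open>Reconstruction is linear in the moments, so zero moments give zero. This replaces an
  appeal to the Vandermonde determinant.\<close>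

lemma vanishing_moments:
  fixes e :: "int \<Rightarrow> real"
  assumes "finite T" "S \<subseteq> T" "card S \<le> k" "\<And>u. u \<in> T - S \<Longrightarrow> e u = 0" "t \<in> T"
    and "\<And>r. r < k \<Longrightarrow> (\<Sum>u\<in>T. e u * of_int u ^ r) = 0"
  shows "e t = 0"
proof -
  have "recovered k S (\<lambda>_. 0) t = e t"
    using assms by (intro recovered_moments) auto
  then show ?thesis by (simp add: recovered_def split: if_splits)
qed

subsection \<open>Moments of line sums\<close>

text \<open>The lines that meet \<open>A\<close>. All other line sums vanish, so moments are finite
  sums over this set.\<close>

definition lines :: "(int \<times> int) set \<Rightarrow> int \<times> int \<Rightarrow> int set" where
  "lines A v = (\<lambda>(i, j). snd v * i - fst v * j) ` A"

lemma finite_lines: "finite A \<Longrightarrow> finite (lines A v)"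
  by (simp add: lines_def)

lemma finite_grid: "finite (grid m n)"
proof -
  have "grid m n = {0..<int m} \<times> {0..<int n}" by (auto simp: grid_def)
  then show ?thesis by simp
qed

lemma line_sum_outside:
  assumes "t \<notin> lines A v"
  shows "line_sum A v f t = 0"
proof -
  have "{(i, j) \<in> A. snd v * i - fst v * j = t} = {}"
    using assms by (force simp: lines_def)
  then show ?thesis unfolding line_sum_def by (simp only: sum.empty)
qed

lemma moment_line_sum:
  assumes "finite A"
  shows "(\<Sum>t\<in>lines A v. line_sum A v f t * of_int t ^ r)
    = (\<Sum>(i, j)\<in>A. f (i, j) * of_int (snd v * i - fst v * j) ^ r)"
proof -
  let ?g = "\<lambda>(i, j). snd v * i - fst v * j"
  have "(\<Sum>(i, j)\<in>A. f (i, j) * of_int (snd v * i - fst v * j) ^ r)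
      = (\<Sum>t\<in>?g ` A. \<Sum>(i, j)\<in>{x \<in> A. ?g x = t}. f (i, j) * of_int (snd v * i - fst v * j) ^ r)"
    by (rule sum.image_gen[OF assms])
  also have "\<dots> = (\<Sum>t\<in>lines A v. line_sum A v f t * of_int t ^ r)"
    unfolding lines_def line_sum_def sum_distrib_right
    by (intro sum.cong refl) (auto simp del: of_int_diff of_int_mult)
  finally show ?thesis by simp
qed

text \<open>Coprimality makes \<open>a\<close> and \<open>a'\<close> divide each other, and
  nonnegativity makes them equal; for \<open>a = 0\<close> the normalisation \<open>b = 1\<close>
  decides.\<close>

lemma direction_eqI:
  assumes "direction (a, b)" "direction (a', b')" "a * b' = a' * b"
  shows "(a, b) = (a', b')"
proof -
  have c: "coprime a b" "coprime a' b'" "0 \<le> a" "0 \<le> a'" "a = 0 \<Longrightarrow> b = 1" "a' = 0 \<Longrightarrow> b' = 1"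
    using assms by (auto simp: direction_def)
  have "a dvd a'" using c(1) assms(3) by (metis coprime_dvd_mult_left_iff dvd_triv_left)
  moreover have "a' dvd a" using c(2) assms(3) by (metis coprime_dvd_mult_left_iff dvd_triv_left)
  ultimately have "a = a'" using c by (simp add: zdvd_antisym_nonneg)
  then show ?thesis using c assms(3) by (cases "a = 0") auto
qed

text \<open>Up to a scalar factor, the power is the value of a polynomial of degree at most
  \<open>r\<close> at a node attached to the direction, and more than \<open>r\<close> nodes are
  available. The Lagrange coefficients depend on the nodes only, so one \<open>c\<close> serves all
  \<open>i\<close> and \<open>j\<close>.\<close>

lemma power_form_combination:
  fixes D :: "nat \<Rightarrow> int \<times> int"
  assumes K: "finite K" "r < card K" and dir: "\<forall>h\<in>K. direction (D h)" and inj: "inj_on D K"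
    and v: "direction v"
  shows "\<exists>c :: nat \<Rightarrow> rat. \<forall>i j. of_int (snd v * i - fst v * j) ^ r
    = (\<Sum>h\<in>K. c h * of_int (snd (D h) * i - fst (D h) * j) ^ r)"
proof -
  \<comment> \<open>The shear \<open>(a, b) \<mapsto> (a, N a + b)\<close> makes every second coordinate positive, so that
    the directions become distinct points of an affine line.\<close>
  define N where "N = 1 + \<bar>snd v\<bar> + (\<Sum>h\<in>K. \<bar>snd (D h)\<bar>)"
  define w where "w = (\<lambda>u :: int \<times> int. N * fst u + snd u)"
  define z where "z = (\<lambda>u. of_int (fst u) / of_int (w u) :: rat)"
  have pos: "w u > 0" if "direction u" "\<bar>snd u\<bar> < N" for u
  proof (cases "fst u = 0")
    case True
    then show ?thesis using that by (cases u) (auto simp: direction_def w_def)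
  next
    case False
    then have "1 \<le> fst u" using that(1) by (cases u) (auto simp: direction_def)
    then have "N * 1 \<le> N * fst u" using that(2) by (intro mult_left_mono) auto
    then show ?thesis using that(2) by (simp add: w_def)
  qed
  have "0 \<le> (\<Sum>h\<in>K. \<bar>snd (D h)\<bar>)" by (rule sum_nonneg) simp
  then have "\<bar>snd v\<bar> < N" unfolding N_def by linarith
  then have wv: "w v > 0" using v by (intro pos)
  have wD: "w (D h) > 0" if h: "h \<in> K" for h
  proof -
    have "\<bar>snd (D h)\<bar> \<le> (\<Sum>h\<in>K. \<bar>snd (D h)\<bar>)"
      using K h by (intro member_le_sum) auto
    then show ?thesis using dir h by (intro pos) (auto simp: N_def)
  qed
  have inj_z: "inj_on (z \<circ> D) K"
  proof (rule inj_onI)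
    fix g h assume gh: "g \<in> K" "h \<in> K" "(z \<circ> D) g = (z \<circ> D) h"
    then have "(of_int (fst (D g) * w (D h)) :: rat) = of_int (fst (D h) * w (D g))"
      using wD[OF gh(1)] wD[OF gh(2)] by (simp add: z_def field_simps)
    then have "fst (D g) * w (D h) = fst (D h) * w (D g)" by (simp only: of_int_eq_iff)
    \<comment> \<open>The common term \<open>N * fst (D g) * fst (D h)\<close> cancels.\<close>
    then have "fst (D g) * snd (D h) = fst (D h) * snd (D g)"
      by (simp add: w_def algebra_simps)
    then have "D g = D h"
      using direction_eqI[of "fst (D g)" "snd (D g)" "fst (D h)" "snd (D h)"] dir gh by simp
    then show "g = h" using inj gh by (simp add: inj_on_def)
  qed
  define Z where "Z = (z \<circ> D) ` K"
  have Z: "finite Z" "card Z = card K" using K card_image[OF inj_z] by (simp_all only: Z_def finite_imageI)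
  \<comment> \<open>Interpolation weights at the node of \<open>v\<close>, rescaled because each
    form carries a factor \<open>w ^ r\<close>.\<close>
  define c where "c = (\<lambda>h. of_int (w v) ^ r * poly (lagrange_basis Z (z (D h))) (z v)
    / of_int (w (D h)) ^ r)"
  \<comment> \<open>Substituting \<open>snd u = w u - N * fst u\<close> gives
    \<open>w u * i - fst u * (j + N * i)\<close>, which is affine in \<open>z u\<close> after
    division by \<open>w u\<close>.\<close>
  have form: "of_int (snd u * i - fst u * j) ^ r
      = of_int (w u) ^ r * poly ([:of_int i, - of_int (j + N * i):] ^ r) (z u)"
    if "w u > 0" for u i j
  proof -
    have "(of_int (snd u * i - fst u * j) :: rat)
        = of_int (w u) * poly [:of_int i, - of_int (j + N * i):] (z u)"
      using that by (simp add: z_def field_simps) (simp add: w_def algebra_simps)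
    then show ?thesis by (simp only: power_mult_distrib poly_power)
  qed
  have "of_int (snd v * i - fst v * j) ^ r
    = (\<Sum>h\<in>K. c h * of_int (snd (D h) * i - fst (D h) * j) ^ r)" for i j
  proof -
    define p where "p = [:of_int i, - of_int (j + N * i) :: rat:] ^ r"
    have "degree p \<le> degree [:of_int i, - of_int (j + N * i) :: rat:] * r"
      unfolding p_def by (rule degree_power_le)
    also have "\<dots> \<le> 1 * r" by (rule mult_right_mono) auto
    finally have "degree p < card Z" using K Z by simp
    then have "poly p (z v) = (\<Sum>s\<in>Z. poly p s * poly (lagrange_basis Z s) (z v))"
      by (rule lagrange_interpolation[OF Z(1)])
    also have "\<dots> = (\<Sum>h\<in>K. poly p (z (D h)) * poly (lagrange_basis Z (z (D h))) (z v))"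
      unfolding Z_def by (subst sum.reindex[OF inj_z]) simp
    finally have "of_int (snd v * i - fst v * j) ^ r = of_int (w v) ^ r *
        (\<Sum>h\<in>K. poly p (z (D h)) * poly (lagrange_basis Z (z (D h))) (z v))"
      using form[OF wv] by (simp add: p_def)
    also have "\<dots> = (\<Sum>h\<in>K. c h * of_int (snd (D h) * i - fst (D h) * j) ^ r)"
      unfolding sum_distrib_left
    proof (rule sum.cong)
      fix h assume "h \<in> K"
      then have "w (D h) > 0" by (rule wD)
      then show "of_int (w v) ^ r * (poly p (z (D h)) * poly (lagrange_basis Z (z (D h))) (z v))
          = c h * of_int (snd (D h) * i - fst (D h) * j) ^ r"
        unfolding form[OF \<open>w (D h) > 0\<close>] by (simp add: c_def p_def)
    qed simp
    finally show ?thesis .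
  qed
  then show ?thesis by blast
qed

text \<open>Summing the identity for the forms against \<open>f\<close>. The coefficients are chosen
  before \<open>f\<close>, so they are available although \<open>f\<close> is unknown.\<close>

lemma moment_combination:
  fixes D :: "nat \<Rightarrow> int \<times> int"
  assumes A: "finite A" and "finite K" "r < card K" "\<forall>h\<in>K. direction (D h)" "inj_on D K"
    "direction v"
  shows "\<exists>c :: nat \<Rightarrow> rat. \<forall>f. (\<Sum>t\<in>lines A v. line_sum A v f t * of_int t ^ r)
    = (\<Sum>h\<in>K. of_rat (c h) * (\<Sum>t\<in>lines A (D h). line_sum A (D h) f t * of_int t ^ r))"
proof -
  obtain c :: "nat \<Rightarrow> rat" where c: "\<And>i j. of_int (snd v * i - fst v * j) ^ r
      = (\<Sum>h\<in>K. c h * of_int (snd (D h) * i - fst (D h) * j) ^ r)"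
    using power_form_combination[OF assms(2-6)] by blast
  have c_real: "real_of_int (snd v * i - fst v * j) ^ r
      = (\<Sum>h\<in>K. of_rat (c h) * real_of_int (snd (D h) * i - fst (D h) * j) ^ r)" for i j
  proof -
    have "real_of_int (snd v * i - fst v * j) ^ r = of_rat (of_int (snd v * i - fst v * j) ^ r)"
      by (simp only: of_rat_power of_rat_of_int_eq)
    then show ?thesis
      by (simp only: c of_rat_sum of_rat_mult of_rat_power of_rat_of_int_eq)
  qed
  have "(\<Sum>t\<in>lines A v. line_sum A v f t * of_int t ^ r)
    = (\<Sum>h\<in>K. of_rat (c h) * (\<Sum>t\<in>lines A (D h). line_sum A (D h) f t * of_int t ^ r))" for f
    unfolding moment_line_sum[OF A] c_real sum_distrib_left
    by (subst sum.swap) (intro sum.cong refl, auto simp: mult_ac)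
  then show ?thesis by blast
qed

subsection \<open>Functions computed by programs\<close>

definition computes :: "'x set \<Rightarrow> ('x \<Rightarrow> 'v \<Rightarrow> real) \<Rightarrow> ('x \<Rightarrow> real) \<Rightarrow> bool" where
  "computes X obs v \<longleftrightarrow> (\<exists>p. \<forall>x\<in>X. run p (obs x) = v x)"

lemma computes_input: "(\<And>x. x \<in> X \<Longrightarrow> obs x i = v x) \<Longrightarrow> computes X obs v"
  unfolding computes_def by (rule exI[of _ "Input i"]) simp

lemma computes_rat: "computes X obs (\<lambda>_. of_rat c)"
  unfolding computes_def by (rule exI[of _ "Const c"]) simp

lemma computes_of_int: "computes X obs (\<lambda>_. of_int c)"
  using computes_rat[of X obs "of_int c"] by simp

lemma computes_add: "computes X obs u \<Longrightarrow> computes X obs v \<Longrightarrow> computes X obs (\<lambda>x. u x + v x)"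
  unfolding computes_def by (metis run.simps(3))

lemma computes_diff: "computes X obs u \<Longrightarrow> computes X obs v \<Longrightarrow> computes X obs (\<lambda>x. u x - v x)"
  unfolding computes_def by (metis run.simps(4))

lemma computes_mult: "computes X obs u \<Longrightarrow> computes X obs v \<Longrightarrow> computes X obs (\<lambda>x. u x * v x)"
  unfolding computes_def by (metis run.simps(5))

lemma computes_power: "computes X obs u \<Longrightarrow> computes X obs (\<lambda>x. u x ^ r)"
proof (induction r)
  case 0
  show ?case using computes_of_int[of X obs 1] by simp
next
  case (Suc r)
  then show ?case by (simp add: computes_mult)
qed

lemma computes_sum:
  assumes "\<And>i. i \<in> I \<Longrightarrow> computes X obs (v i)"
  shows "computes X obs (\<lambda>x. \<Sum>i\<in>I. v i x)"
  using assms
proof (induction I rule: infinite_finite_induct)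
  case (insert i I)
  then show ?case by (simp add: computes_add)
qed (use computes_of_int[of X obs 0] in simp_all)

lemmas computes_intros =
  computes_rat computes_of_int computes_add computes_diff computes_mult computes_power computes_sum

lemma computes_recovered:
  assumes "\<And>r. r < k \<Longrightarrow> computes X obs (\<lambda>x. s x r)"
  shows "computes X obs (\<lambda>x. recovered k S (s x) t)"
proof (cases "t \<in> S")
  case True
  then show ?thesis
    unfolding recovered_def by (simp, intro computes_intros assms) simp
next
  case False
  then show ?thesis
    using computes_of_int[of X obs 0] by (simp add: recovered_def)
qed

text \<open>Nested comparisons return the first candidate that passes its test. Every candidate that
  passes is correct, so the order of the search is irrelevant.\<close>

lemma computes_search:
  assumes I: "finite I"
    and cond: "\<And>i. i \<in> I \<Longrightarrow> computes X obs (c i)"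
    and cand: "\<And>i. i \<in> I \<Longrightarrow> computes X obs (v i)"
    and ex: "\<And>x. x \<in> X \<Longrightarrow> \<exists>i\<in>I. c i x \<le> 0"
    and sound: "\<And>x i. x \<in> X \<Longrightarrow> i \<in> I \<Longrightarrow> c i x \<le> 0 \<Longrightarrow> v i x = y x"
  shows "computes X obs y"
proof -
  \<comment> \<open>Conditional, since a smaller index set may contain no passing candidate.\<close>
  have "\<exists>p. \<forall>x\<in>X. (\<exists>i\<in>I. c i x \<le> 0) \<longrightarrow> run p (obs x) = y x"
    using I cond cand sound
  proof (induction I rule: finite_induct)
    case (insert i I)
    then obtain p where p: "\<forall>x\<in>X. (\<exists>i\<in>I. c i x \<le> 0) \<longrightarrow> run p (obs x) = y x"
      by (metis insertCI)
    obtain pc pv where "\<forall>x\<in>X. run pc (obs x) = c i x" "\<forall>x\<in>X. run pv (obs x) = v i x"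
      using insert.prems(1,2)[of i] unfolding computes_def by auto
    then show ?case
      using p insert.prems(3) by (intro exI[of _ "IfLe pc (Const 0) pv p"]) auto
  qed auto
  then show ?thesis unfolding computes_def using ex by blast
qed

text \<open>A program sees only the observation, so its correctness already implies
  uniqueness.\<close>

lemma can_be_determinedI:
  assumes T: "finite T" and outside: "\<And>x t. x \<in> X \<Longrightarrow> t \<notin> T \<Longrightarrow> val x t = 0"
    and inside: "\<And>t. t \<in> T \<Longrightarrow> computes X obs (\<lambda>x. val x t)"
  shows "can_be_determined X obs val"
proof -
  obtain p where p: "\<And>t x. t \<in> T \<Longrightarrow> x \<in> X \<Longrightarrow> run (p t) (obs x) = val x t"
    using inside unfolding computes_def by metis
  define P where "P = (\<lambda>t. if t \<in> T then p t else Const 0)"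
  have run: "run (P t) (obs x) = val x t" if "x \<in> X" for x t
    using p outside that by (simp add: P_def)
  have "{t. P t \<noteq> Const 0} \<subseteq> T" by (auto simp: P_def)
  then have "computable_from X obs val"
    unfolding computable_from_def using T run finite_subset by blast
  moreover have "uniquely_determined X obs val"
    unfolding uniquely_determined_def using run by (metis ext)
  ultimately show ?thesis unfolding can_be_determined_def by blast
qed

subsection \<open>Correcting errors\<close>

text \<open>Here \<open>g x t\<close> is the measured value, \<open>val x t\<close> the correct one, and \<open>s x r\<close> the \<open>r\<close>-th moment of
  the error, obtained from the data.\<close>

lemma computes_correction_unknown_set:
  assumes T: "finite T"
    and g: "\<And>t. t \<in> T \<Longrightarrow> computes X obs (\<lambda>x. g x t)"
    and s: "\<And>r. r < k \<Longrightarrow> computes X obs (\<lambda>x. s x r)"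
    and moments: "\<And>x r. x \<in> X \<Longrightarrow> r < k \<Longrightarrow> s x r = (\<Sum>u\<in>T. (g x u - val x u) * of_int u ^ r)"
    and few: "\<And>x. x \<in> X \<Longrightarrow> 2 * card {t \<in> T. g x t \<noteq> val x t} < k"
    and t: "t \<in> T"
  shows "computes X obs (\<lambda>x. val x t)"
\<comment> \<open>A sum of squares tests all \<open>k\<close> moment equations by a single
  comparison with 0.\<close>
proof (rule computes_search[where I = "{S. S \<subseteq> T \<and> 2 * card S < k}"
      and v = "\<lambda>S x. g x t - recovered k S (s x) t"
      and c = "\<lambda>S x. \<Sum>r<k. (s x r - (\<Sum>u\<in>T. recovered k S (s x) u * of_int u ^ r))\<^sup>2"])
  show "finite {S. S \<subseteq> T \<and> 2 * card S < k}" using T by simp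
next
  fix S
  show "computes X obs (\<lambda>x. \<Sum>r<k. (s x r - (\<Sum>u\<in>T. recovered k S (s x) u * of_int u ^ r))\<^sup>2)"
    by (intro computes_intros computes_recovered s) auto
  show "computes X obs (\<lambda>x. g x t - recovered k S (s x) t)"
    by (intro computes_intros computes_recovered s g t)
next
  fix x assume x: "x \<in> X"
  let ?S = "{t \<in> T. g x t \<noteq> val x t}"
  have "recovered k ?S (s x) u = g x u - val x u" if "u \<in> T" for u
    using T few[OF x] that moments[OF x] by (intro recovered_moments) auto
  then have "(\<Sum>r<k. (s x r - (\<Sum>u\<in>T. recovered k ?S (s x) u * of_int u ^ r))\<^sup>2) \<le> 0"
    using moments[OF x] by simp
  then show "\<exists>S\<in>{S. S \<subseteq> T \<and> 2 * card S < k}.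
      (\<Sum>r<k. (s x r - (\<Sum>u\<in>T. recovered k S (s x) u * of_int u ^ r))\<^sup>2) \<le> 0"
    using few[OF x] by (intro bexI[of _ ?S]) auto
next
  fix x S assume x: "x \<in> X" and S: "S \<in> {S. S \<subseteq> T \<and> 2 * card S < k}"
    and le: "(\<Sum>r<k. (s x r - (\<Sum>u\<in>T. recovered k S (s x) u * of_int u ^ r))\<^sup>2) \<le> 0"
  let ?E = "{t \<in> T. g x t \<noteq> val x t}"
  let ?e = "\<lambda>u. g x u - val x u - recovered k S (s x) u"
  have "(\<Sum>r<k. (s x r - (\<Sum>u\<in>T. recovered k S (s x) u * of_int u ^ r))\<^sup>2) = 0"
    using le by (intro antisym sum_nonneg) auto
  then have eq: "s x r = (\<Sum>u\<in>T. recovered k S (s x) u * of_int u ^ r)" if "r < k" for r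
    using that by (subst (asm) sum_nonneg_eq_0_iff) auto
  \<comment> \<open>The true and the reconstructed error have the same first \<open>k\<close>
    moments, and their difference lives on \<open>?E \<union> S\<close>, which has at most
    \<open>k\<close> points.\<close>
  have "?e t = 0"
  proof (rule vanishing_moments[OF T, where S = "?E \<union> S"])
    have "card (?E \<union> S) \<le> card ?E + card S" by (rule card_Un_le)
    then show "card (?E \<union> S) \<le> k" using few[OF x] S by simp
    fix r assume "r < k"
    then show "(\<Sum>u\<in>T. ?e u * of_int u ^ r) = 0"
      using eq moments[OF x] by (simp add: left_diff_distrib sum_subtractf)
  qed (use S t in \<open>auto simp: recovered_def\<close>)
  then show "g x t - recovered k S (s x) t = val x t" by simp
qed

text \<open>The coefficients of the reconstruction vary with the error set, which differs between
  situations. The program therefore compares the given indicator with every subset of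
  \<open>T\<close> and uses the formula of the matching one.\<close>

lemma computes_correction_known_set:
  assumes T: "finite T"
    and g: "\<And>t. t \<in> T \<Longrightarrow> computes X obs (\<lambda>x. g x t)"
    and s: "\<And>r. r < k \<Longrightarrow> computes X obs (\<lambda>x. s x r)"
    and known: "\<And>t. t \<in> T \<Longrightarrow> computes X obs (\<lambda>x. indicator {t. g x t \<noteq> val x t} t)"
    and moments: "\<And>x r. x \<in> X \<Longrightarrow> r < k \<Longrightarrow> s x r = (\<Sum>u\<in>T. (g x u - val x u) * of_int u ^ r)"
    and few: "\<And>x. x \<in> X \<Longrightarrow> card {t \<in> T. g x t \<noteq> val x t} \<le> k"
    and t: "t \<in> T"
  shows "computes X obs (\<lambda>x. val x t)"
proof (rule computes_search[where I = "Pow T"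
      and v = "\<lambda>S x. g x t - recovered k S (s x) t"
      and c = "\<lambda>S x. \<Sum>u\<in>T. (indicator {t. g x t \<noteq> val x t} u - of_int (indicator S u))\<^sup>2"])
  show "finite (Pow T)" using T by simp
next
  fix S
  show "computes X obs (\<lambda>x. \<Sum>u\<in>T. (indicator {t. g x t \<noteq> val x t} u - of_int (indicator S u))\<^sup>2)"
    by (intro computes_intros known)
  show "computes X obs (\<lambda>x. g x t - recovered k S (s x) t)"
    by (intro computes_intros computes_recovered s g t)
next
  fix x assume x: "x \<in> X"
  have "(\<Sum>u\<in>T. (indicator {t. g x t \<noteq> val x t} u
      - real_of_int (indicator {t \<in> T. g x t \<noteq> val x t} u))\<^sup>2) = 0"
    by (rule sum.neutral) (auto simp: indicator_def)
  then show "\<exists>S\<in>Pow T. (\<Sum>u\<in>T. (indicator {t. g x t \<noteq> val x t} u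
      - real_of_int (indicator S u))\<^sup>2) \<le> 0"
    by (intro bexI[of _ "{t \<in> T. g x t \<noteq> val x t}"]) auto
next
  fix x S assume x: "x \<in> X" and S: "S \<in> Pow T"
    and le: "(\<Sum>u\<in>T. (indicator {t. g x t \<noteq> val x t} u - real_of_int (indicator S u))\<^sup>2) \<le> 0"
  have "(\<Sum>u\<in>T. (indicator {t. g x t \<noteq> val x t} u - real_of_int (indicator S u))\<^sup>2) = 0"
    using le by (intro antisym sum_nonneg) auto
  then have "\<forall>u\<in>T. (indicator {t. g x t \<noteq> val x t} u - real_of_int (indicator S u))\<^sup>2 = 0"
    using T by (subst (asm) sum_nonneg_eq_0_iff) auto
  then have "\<forall>u\<in>T. g x u \<noteq> val x u \<longleftrightarrow> u \<in> S"
    by (auto simp: indicator_def of_bool_def split: if_splits)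
  then have "S = {t \<in> T. g x t \<noteq> val x t}" using S by blast
  then have "recovered k S (s x) t = g x t - val x t"
    using T few[OF x] t moments[OF x] by (intro recovered_moments) auto
  then show "g x t - recovered k S (s x) t = val x t" by simp
qed

section \<open>Both claims for the line sums of the grid\<close>

theorem theorem2p2:
  fixes d m n k :: nat and D :: "nat \<Rightarrow> int \<times> int"
  defines "A \<equiv> grid m n"
  assumes "0 < d" and "0 < m" and "0 < n"
    and "\<forall>h\<in>{1..d}. direction (D h)"
    and "inj_on D {1..d}"
    and "1 \<le> k" and "k < d"
  shows "\<forall>H. k < H \<and> H \<le> d \<longrightarrow>
     can_be_determined
       {(f, ms). (\<forall>h\<in>{1..k}. \<forall>t. ms h t = line_sum A (D h) f t) \<and>
          finite (wrong_line_sums A (D H) f (ms H)) \<and>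
          real (card (wrong_line_sums A (D H) f (ms H))) < real k / 2}
       (\<lambda>(f, ms). measured_data d ms)
       (\<lambda>(f, ms) t. line_sum A (D H) f t)
   \<and> can_be_determined
       {(f, ms). (\<forall>h\<in>{1..k}. \<forall>t. ms h t = line_sum A (D h) f t) \<and>
          finite (wrong_line_sums A (D H) f (ms H)) \<and>
          card (wrong_line_sums A (D H) f (ms H)) \<le> k}
       (\<lambda>(f, ms). measured_data_with_set d ms (wrong_line_sums A (D H) f (ms H)))
       (\<lambda>(f, ms) t. line_sum A (D H) f t)"
proof (intro allI impI)
  fix H assume H: "k < H \<and> H \<le> d"
  define T where "T = lines A (D H)"
  have A: "finite A" by (simp add: A_def finite_grid)
  have T: "finite T" by (simp add: T_def finite_lines A)
  have good: "\<forall>h\<in>{1..k}. direction (D h)" "inj_on D {1..k}" "direction (D H)"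
    using assms(5-8) H by (auto intro: inj_on_subset)
  have "\<forall>r\<in>{..<k}. \<exists>c :: nat \<Rightarrow> rat. \<forall>f. (\<Sum>t\<in>T. line_sum A (D H) f t * of_int t ^ r)
      = (\<Sum>h\<in>{1..k}. of_rat (c h) * (\<Sum>t\<in>lines A (D h). line_sum A (D h) f t * of_int t ^ r))"
    unfolding T_def using good by (intro ballI moment_combination[OF A]) auto
  from bchoice[OF this] obtain c :: "nat \<Rightarrow> nat \<Rightarrow> rat" where
    c: "\<And>r f. r < k \<Longrightarrow> (\<Sum>t\<in>T. line_sum A (D H) f t * of_int t ^ r)
      = (\<Sum>h\<in>{1..k}. of_rat (c r h) * (\<Sum>t\<in>lines A (D h). line_sum A (D h) f t * of_int t ^ r))"
    by blast
  \<comment> \<open>The unknown moments of the correct sums in direction \<open>H\<close> are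
    expressed through measured sums in the first \<open>k\<close> directions, so \<open>s\<close>
    uses data only.\<close>
  define s :: "(int \<times> int \<Rightarrow> real) \<times> (nat \<Rightarrow> int \<Rightarrow> real) \<Rightarrow> nat \<Rightarrow> real" where
    "s = (\<lambda>x r. (\<Sum>t\<in>T. snd x H t * of_int t ^ r)
      - (\<Sum>h\<in>{1..k}. of_rat (c r h) * (\<Sum>t\<in>lines A (D h). snd x h t * of_int t ^ r)))"
  have s: "s x r = (\<Sum>u\<in>T. (snd x H u - line_sum A (D H) (fst x) u) * of_int u ^ r)"
    if "\<forall>h\<in>{1..k}. \<forall>t. snd x h t = line_sum A (D h) (fst x) t" "r < k" for x r
    using that c[OF that(2), of "fst x"] by (simp add: s_def left_diff_distrib sum_subtractf)
  \<comment> \<open>The observation is left arbitrary because the two claims supply different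
    inputs.\<close>
  have comp_s: "computes X obs (\<lambda>x. s x r)"
    if "\<And>h t. h \<in> {1..d} \<Longrightarrow> computes X obs (\<lambda>x. snd x h t)"
    for X :: "((int \<times> int \<Rightarrow> real) \<times> (nat \<Rightarrow> int \<Rightarrow> real)) set"
      and obs :: "_ \<Rightarrow> 'v \<Rightarrow> real" and r
    unfolding s_def using H assms(7,8) by (intro computes_intros that) auto
  \<comment> \<open>Measured values may also be wrong outside \<open>T\<close>, but there the
    correct sum is 0; only errors inside \<open>T\<close> are reconstructed.\<close>
  have card_T: "card {t \<in> T. ms t \<noteq> line_sum A (D H) f t} \<le> card (wrong_line_sums A (D H) f ms)"
    if "finite (wrong_line_sums A (D H) f ms)" for f ms
    using that by (intro card_mono) (auto simp: wrong_line_sums_def)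

  show "can_be_determined
       {(f, ms). (\<forall>h\<in>{1..k}. \<forall>t. ms h t = line_sum A (D h) f t) \<and>
          finite (wrong_line_sums A (D H) f (ms H)) \<and>
          real (card (wrong_line_sums A (D H) f (ms H))) < real k / 2}
       (\<lambda>(f, ms). measured_data d ms)
       (\<lambda>(f, ms) t. line_sum A (D H) f t)
   \<and> can_be_determined
       {(f, ms). (\<forall>h\<in>{1..k}. \<forall>t. ms h t = line_sum A (D h) f t) \<and>
          finite (wrong_line_sums A (D H) f (ms H)) \<and>
          card (wrong_line_sums A (D H) f (ms H)) \<le> k}
       (\<lambda>(f, ms). measured_data_with_set d ms (wrong_line_sums A (D H) f (ms H)))
       (\<lambda>(f, ms) t. line_sum A (D H) f t)"
    (is "can_be_determined ?X1 ?obs1 ?val \<and> can_be_determined ?X2 ?obs2 ?val")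
  proof
    have in1: "computes ?X1 ?obs1 (\<lambda>x. snd x h t)" if "h \<in> {1..d}" for h t
      using that by (intro computes_input[where i = "(h, t)"]) (auto simp: measured_data_def)
    show "can_be_determined ?X1 ?obs1 ?val"
    proof (rule can_be_determinedI[OF T])
      fix t assume t: "t \<in> T"
      show "computes ?X1 ?obs1 (\<lambda>x. ?val x t)"
      proof (rule computes_correction_unknown_set[OF T _ _ _ _ t, where g = "\<lambda>x. snd x H" and s = s])
        fix x assume x: "x \<in> ?X1"
        show "2 * card {t \<in> T. snd x H t \<noteq> ?val x t} < k"
          using x card_T[of "fst x" "snd x H"] by (auto simp: field_simps)
        fix r assume "r < k"
        then show "s x r = (\<Sum>u\<in>T. (snd x H u - ?val x u) * of_int u ^ r)"
          using x s[of x r] by (auto simp: case_prod_beta)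
      qed (use H in1 comp_s[OF in1] in auto)
    qed (auto simp: T_def line_sum_outside)
    have in2: "computes ?X2 ?obs2 (\<lambda>x. snd x h t)" if "h \<in> {1..d}" for h t
      using that by (intro computes_input[where i = "Inl (h, t)"])
        (auto simp: measured_data_def measured_data_with_set_def)
    show "can_be_determined ?X2 ?obs2 ?val"
    proof (rule can_be_determinedI[OF T])
      fix t assume t: "t \<in> T"
      show "computes ?X2 ?obs2 (\<lambda>x. ?val x t)"
      proof (rule computes_correction_known_set[OF T _ _ _ _ _ t, where g = "\<lambda>x. snd x H" and s = s])
        fix x assume x: "x \<in> ?X2"
        show "card {t \<in> T. snd x H t \<noteq> ?val x t} \<le> k"
          using x card_T[of "fst x" "snd x H"] by auto
        fix r assume "r < k"
        then show "s x r = (\<Sum>u\<in>T. (snd x H u - ?val x u) * of_int u ^ r)"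
          using x s[of x r] by (auto simp: case_prod_beta)
      next
        fix t
        show "computes ?X2 ?obs2 (\<lambda>x. indicator {t. snd x H t \<noteq> ?val x t} t)"
          by (intro computes_input[where i = "Inr t"])
            (auto simp: measured_data_with_set_def wrong_line_sums_def)
      qed (use H in2 comp_s[OF in2] in auto)
    qed (auto simp: T_def line_sum_outside)
  qed
qed

end
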